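(* Let $f=(f_1,\dots,f_m):\mathscr{D}(f)\subseteq\mathbb{R}^n\to\mathbb{R}^m$ be a nonlinear function and $x_0\in\mathscr{D}(f)$. Assume that (i) $f$ satisfies the local tangential cone condition in the ball $\mathscr{B}_\rho(x_0)$; (ii) for every $x\in\mathscr{D}(f)$ the Jacobian $f'(x)$ is row bounded below and is a full column rank matrix; and that $f(x)=0$ is solvable in $\mathscr{B}_{\rho/2}(x_0)$. Then the iteration sequence $\{x_k\}_{k=0}^\infty$ generated by the NSKM method (started at $x_0$) converges in expectation to a solution $x^*\in\mathscr{B}_{\rho/2}(x_0)$ of $f(x)=0$. Moreover, the mean squared iteration error satisfies, for $k=1,2,\dots$, $$E\|x_k-x^*\|^2\le\left(1-\frac{(1-2\eta)\,\sigma_{\min}^2(f'(x_{k-1}))}{m(1+\eta)^2\|f'(x_{k-1})\|_F^2}\right)E\|x_{k-1}-x^*\|^2,$$ where $\eta=\max_i\eta_i<\frac12$ $(i=1,\dots,m)$ is the constant of the local tangential cone condition.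
   Context: $f$ is differentiable, with Jacobian $f'(x)\in\mathbb{R}^{m\times n}$ whose $i$th row is the gradient $\nabla f_i(x)$ (a row vector). $\|\cdot\|$ is the Euclidean norm, $\|\cdot\|_F$ the Frobenius norm, $\sigma_{\min}(A)$ the smallest nonzero singular value of $A$. $\mathscr{B}_r(x_0)=\{x:\|x-x_0\|\le r\}$. Row bounded below: a matrix $A\in\mathbb{R}^{m\times n}$ is row bounded below if there is $\varepsilon>0$ with $\|A(i,:)\|\ge\varepsilon$ for all $1\le i\le m$, where $A(i,:)$ is the $i$th row. Local tangential cone condition: $f$ satisfies it in the ball $\mathscr{B}_\rho(x_0)\subset\mathscr{D}(f)$ of radius $\rho$ around $x_0$ if for every $i\in\{1,\dots,m\}$ and all $x_1,x_2\in\mathscr{B}_\rho(x_0)$ there exists $\eta_i\in[0,\eta]$, where $\eta=\max_i\eta_i<\frac12$, such that $|f_i(x_1)-f_i(x_2)-\nabla f_i(x_1)(x_1-x_2)|\le\eta_i|f_i(x_1)-f_i(x_2)|$. NSKM method (nonlinear sampling Kaczmarz-Motzkin): fix a sample size $\beta\in\{1,\dots,m\}$ and the initial point $x_0$. For $k=1,2,\dots$: choose a subset $\tau_k\subseteq\{1,\dots,m\}$ of size $\beta$ uniformly at random; let $i_k\in\arg\max_{i\in\tau_k}|f_i(x_{k-1})|$; set $x_k=x_{k-1}-\frac{f_{i_k}(x_{k-1})}{\|\nabla f_{i_k}(x_{k-1})\|^2}\nabla f_{i_k}(x_{k-1})^T$. $E$ denotes expectation over the random choices of the method; convergence of $x_k$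 to $x^*$ in expectation refers to $E\|x_k-x^*\|^2\to0$. *)

theory Defs
  imports "HOL-Probability.Probability"
begin

text \<open>
  The gradient of the \<open>i\<close>-th component of \<open>f : D \<rightarrow> \<real>\<^sup>m\<close> at \<open>x\<close> is the \<open>i\<close>-th row of the
  Jacobian. Derivatives are taken within \<open>D\<close>; for open \<open>D\<close> these are the ordinary ones.
\<close>

abbreviation Jac :: "(real^'n) set \<Rightarrow> (real^'n \<Rightarrow> real^'m) \<Rightarrow> real^'n \<Rightarrow> real^'n^'m"
  where "Jac D f x \<equiv> jacobian f (at x within D)"

abbreviation grad :: "(real^'n) set \<Rightarrow> (real^'n \<Rightarrow> real^'m) \<Rightarrow> 'm \<Rightarrow> real^'n \<Rightarrow> real^'n"
  where "grad D f i x \<equiv> row i (Jac D f x)"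

definition frobenius_norm :: "real^'n^'m \<Rightarrow> real"
  where "frobenius_norm A = sqrt (\<Sum>i\<in>UNIV. \<Sum>j\<in>UNIV. (A $ i $ j)\<^sup>2)"

text \<open>The singular values of \<open>A\<close> are the square roots of the eigenvalues of \<open>A\<^sup>T A\<close>.\<close>

definition singular_values :: "real^'n^'m \<Rightarrow> real set"
  where "singular_values A =
    {sqrt \<mu> | \<mu>. \<exists>v. v \<noteq> 0 \<and> (transpose A ** A) *v v = \<mu> *\<^sub>R v}"

definition sigma_min :: "real^'n^'m \<Rightarrow> real"
  where "sigma_min A = Min {s \<in> singular_values A. s \<noteq> 0}"

definition row_bounded_below :: "real^'n^'m \<Rightarrow> bool"
  where "row_bounded_below A \<longleftrightarrow> (\<exists>\<epsilon>>0. \<forall>i. norm (row i A) \<ge> \<epsilon>)"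

text \<open>
  The factors \<open>\<eta>\<^sub>i\<close> are allowed to depend on \<open>x\<^sub>1\<close> and \<open>x\<^sub>2\<close>. The condition is the same if they
  depend on \<open>i\<close> only and \<open>\<eta>\<close> is their maximum, see \<open>local_tangential_cone_iff_Max\<close> below.
\<close>

definition local_tangential_cone ::
    "(real^'n) set \<Rightarrow> (real^'n \<Rightarrow> real^'m) \<Rightarrow> real^'n \<Rightarrow> real \<Rightarrow> real \<Rightarrow> bool"
  where "local_tangential_cone D f x0 \<rho> \<eta> \<longleftrightarrow>
    cball x0 \<rho> \<subseteq> D \<and> \<eta> < 1/2 \<and>
    (\<forall>i. \<forall>x1\<in>cball x0 \<rho>. \<forall>x2\<in>cball x0 \<rho>. \<exists>\<eta>\<^sub>i\<in>{0..\<eta>}.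
      \<bar>f x1 $ i - f x2 $ i - grad D f i x1 \<bullet> (x1 - x2)\<bar> \<le> \<eta>\<^sub>i * \<bar>f x1 $ i - f x2 $ i\<bar>)"

lemma local_tangential_cone_iff_Max:
  fixes f :: "real^'n \<Rightarrow> real^'m"
  assumes "0 \<le> \<rho>"
  shows "local_tangential_cone D f x0 \<rho> \<eta> \<longleftrightarrow>
    cball x0 \<rho> \<subseteq> D \<and> \<eta> < 1/2 \<and>
    (\<exists>e :: 'm \<Rightarrow> real. \<eta> = Max (range e) \<and> (\<forall>i. 0 \<le> e i) \<and>
      (\<forall>i. \<forall>x1\<in>cball x0 \<rho>. \<forall>x2\<in>cball x0 \<rho>.
        \<bar>f x1 $ i - f x2 $ i - grad D f i x1 \<bullet> (x1 - x2)\<bar> \<le> e i * \<bar>f x1 $ i - f x2 $ i\<bar>))"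
    (is "_ \<longleftrightarrow> ?B \<and> ?H \<and> (\<exists>e. ?P e)")
proof
  assume L: "local_tangential_cone D f x0 \<rho> \<eta>"
  note L' = L[unfolded local_tangential_cone_def]
  have x0: "x0 \<in> cball x0 \<rho>" using assms by simp
  obtain h where "h \<in> {0..\<eta>}"
    using L'[THEN conjunct2, THEN conjunct2, THEN spec[of _ undefined],
        THEN bspec, OF x0, THEN bspec, OF x0] ..
  then have \<eta>: "0 \<le> \<eta>" by simp
  have *: "\<bar>f x1 $ i - f x2 $ i - grad D f i x1 \<bullet> (x1 - x2)\<bar> \<le> \<eta> * \<bar>f x1 $ i - f x2 $ i\<bar>"
    if x: "x1 \<in> cball x0 \<rho>" "x2 \<in> cball x0 \<rho>" for i x1 x2
  proof -
    obtain h where h: "h \<in> {0..\<eta>}"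
      "\<bar>f x1 $ i - f x2 $ i - grad D f i x1 \<bullet> (x1 - x2)\<bar> \<le> h * \<bar>f x1 $ i - f x2 $ i\<bar>"
      using L'[THEN conjunct2, THEN conjunct2, THEN spec[of _ i],
          THEN bspec, OF x(1), THEN bspec, OF x(2)] ..
    have "h * \<bar>f x1 $ i - f x2 $ i\<bar> \<le> \<eta> * \<bar>f x1 $ i - f x2 $ i\<bar>"
      using h(1) by (intro mult_right_mono) auto
    with h(2) show ?thesis by (rule order_trans)
  qed
  have "\<eta> = Max (range (\<lambda>_ :: 'm. \<eta>))" by simp
  then have "?P (\<lambda>_. \<eta>)" using \<eta> * by (intro conjI allI ballI)
  then have "\<exists>e. ?P e" by (rule exI[of ?P "\<lambda>_. \<eta>"])
  then show "?B \<and> ?H \<and> (\<exists>e. ?P e)"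
    by (intro conjI L'[THEN conjunct1] L'[THEN conjunct2, THEN conjunct1])
next
  assume R: "?B \<and> ?H \<and> (\<exists>e. ?P e)"
  from R[THEN conjunct2, THEN conjunct2] obtain e where e: "?P e" ..
  have mem: "e i \<in> {0..\<eta>}" for i
    using e[THEN conjunct1] e[THEN conjunct2, THEN conjunct1] by simp
  have "\<exists>h\<in>{0..\<eta>}.
      \<bar>f x1 $ i - f x2 $ i - grad D f i x1 \<bullet> (x1 - x2)\<bar> \<le> h * \<bar>f x1 $ i - f x2 $ i\<bar>"
    if x: "x1 \<in> cball x0 \<rho>" "x2 \<in> cball x0 \<rho>" for i x1 x2
    by (rule bexI[OF _ mem[of i]])
      (rule e[THEN conjunct2, THEN conjunct2, THEN spec[of _ i], THEN bspec, OF x(1),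
        THEN bspec, OF x(2)])
  then show "local_tangential_cone D f x0 \<rho> \<eta>"
    unfolding local_tangential_cone_def
    by (intro conjI allI ballI R[THEN conjunct1] R[THEN conjunct2, THEN conjunct1])
qed

text \<open>
  What has been drawn before step \<open>k\<close>: the samples \<open>\<tau>\<^sub>1, \<dots>, \<tau>\<^bsub>k-1\<^esub>\<close> and the selected indices
  \<open>i\<^sub>1, \<dots>, i\<^bsub>k-1\<^esub>\<close>. They determine the iterate \<open>x\<^bsub>k-1\<^esub>\<close>.
\<close>

definition history :: "(nat \<Rightarrow> 'w \<Rightarrow> 'm set) \<Rightarrow> (nat \<Rightarrow> 'w \<Rightarrow> 'm) \<Rightarrow> nat \<Rightarrow> 'w \<Rightarrow> ('m set \<times> 'm) list"
  where "history \<tau> \<iota> k \<omega> = map (\<lambda>j. (\<tau> j \<omega>, \<iota> j \<omega>)) [1..<k]"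

definition history_algebra ::
    "'w measure \<Rightarrow> (nat \<Rightarrow> 'w \<Rightarrow> 'm set) \<Rightarrow> (nat \<Rightarrow> 'w \<Rightarrow> 'm) \<Rightarrow> nat \<Rightarrow> 'w measure"
  where "history_algebra M \<tau> \<iota> k = vimage_algebra (space M) (history \<tau> \<iota> k) (count_space UNIV)"

text \<open>
  Ties in the maximum may be broken by any rule, including a randomised one. The fresh sample
  \<open>\<tau>\<^sub>k\<close> is independent of everything drawn before; in particular a tie-breaking rule cannot look
  ahead to later samples.
\<close>

definition nskm ::
    "'w measure \<Rightarrow> (real^'n) set \<Rightarrow> (real^'n \<Rightarrow> real^'m) \<Rightarrow> nat \<Rightarrow> real^'n \<Rightarrow>
     (nat \<Rightarrow> 'w \<Rightarrow> 'm set) \<Rightarrow> (nat \<Rightarrow> 'w \<Rightarrow> 'm) \<Rightarrow> (nat \<Rightarrow> 'w \<Rightarrow> real^'n) \<Rightarrow> bool"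
  where "nskm M D f \<beta> x0 \<tau> \<iota> x \<longleftrightarrow>
    prob_space M \<and>
    (\<forall>k\<ge>1.
      \<tau> k \<in> measurable M (count_space UNIV) \<and> \<iota> k \<in> measurable M (count_space UNIV) \<and>
      distr M (count_space UNIV) (\<tau> k) = measure_pmf (pmf_of_set {T. card T = \<beta>}) \<and>
      prob_space.indep_set M
        (sets (vimage_algebra (space M) (\<tau> k) (count_space UNIV)))
        (sets (history_algebra M \<tau> \<iota> k))) \<and>
    (\<forall>\<omega>\<in>space M.
      x 0 \<omega> = x0 \<and>
      (\<forall>k\<ge>1.
        is_arg_max (\<lambda>i. \<bar>f (x (k - 1) \<omega>) $ i\<bar>) (\<lambda>i. i \<in> \<tau> k \<omega>) (\<iota> k \<omega>) \<and>
        x k \<omega> = x (k - 1) \<omega> -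
          (f (x (k - 1) \<omega>) $ \<iota> k \<omega> / (norm (grad D f (\<iota> k \<omega>) (x (k - 1) \<omega>)))\<^sup>2) *\<^sub>R
            grad D f (\<iota> k \<omega>) (x (k - 1) \<omega>)))"

definition converges_in_expectation ::
    "'w measure \<Rightarrow> (nat \<Rightarrow> 'w \<Rightarrow> 'a::real_normed_vector) \<Rightarrow> 'a \<Rightarrow> bool"
  where "converges_in_expectation M x z \<longleftrightarrow>
    (\<forall>k. integrable M (\<lambda>\<omega>. (norm (x k \<omega> - z))\<^sup>2)) \<and>
    (\<lambda>k. \<integral>\<omega>. (norm (x k \<omega> - z))\<^sup>2 \<partial>M) \<longlonglongrightarrow> 0"

definition nskm_factor ::
    "(real^'n) set \<Rightarrow> (real^'n \<Rightarrow> real^'m) \<Rightarrow> real \<Rightarrow> real^'n \<Rightarrow> real"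
  where "nskm_factor D f \<eta> x =
    1 - (1 - 2 * \<eta>) * (sigma_min (Jac D f x))\<^sup>2 /
        (real CARD('m) * (1 + \<eta>)\<^sup>2 * (frobenius_norm (Jac D f x))\<^sup>2)"

end

theory Submission
  imports Defs
begin

text \<open>
  Let \<open>z\<close> be a zero of \<open>f\<close> in the ball of radius \<open>\<rho>/2\<close>. Write \<open>J\<^sub>y\<close> for the Jacobian at \<open>y\<close>. For
  \<open>y\<close> in the large ball the tangential cone condition between \<open>y\<close> and \<open>z\<close> says that the \<open>i\<close>-th
  linearised equation at \<open>y\<close> is solved by \<open>z\<close> up to an error \<open>\<eta> * \<bar>f\<^sub>i y\<bar>\<close>. Hence projecting \<open>y\<close> onto
  the solution hyperplane of that equation decreases the squared distance to \<open>z\<close> by at least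
  \<open>(1 - 2 * \<eta>) * (f\<^sub>i y)\<^sup>2 / \<parallel>\<nabla>f\<^sub>i y\<parallel>\<^sup>2\<close> (\<open>kaczmarz_step_decrease\<close>). In particular no iterate is further
  from \<open>z\<close> than \<open>x0\<close>, so all of them stay in the large ball, where the condition is available.

  The selected index maximises \<open>\<bar>f\<^sub>i y\<bar>\<close> over the sample, so its squared residual is at least the mean
  of the squared residuals over the sample; the norm of its row is at most \<open>\<parallel>J\<^sub>y\<parallel>\<^sub>F\<close>. The mean is linear in the indicators of the events that
  \<open>i\<close> is sampled. Each such event has probability \<open>\<beta> / m\<close> and is independent of the history, so
  conditioning on the history replaces the mean over the sample by \<open>\<parallel>f y\<parallel>\<^sup>2 / m\<close>
  (\<open>cond_exp_error_le\<close>): given the history, the expected squared error after the step is at most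
  \<open>\<parallel>y - z\<parallel>\<^sup>2 - (1 - 2 * \<eta>) * \<parallel>f y\<parallel>\<^sup>2 / (m * \<parallel>J\<^sub>y\<parallel>\<^sub>F\<^sup>2)\<close>, where \<open>y\<close> is the current iterate.

  It remains to bound the residual below by the error. By the cone condition,
  \<open>\<sigma>\<^sup>2 * \<parallel>y - z\<parallel>\<^sup>2 \<le> (1 + \<eta>)\<^sup>2 * \<parallel>f y\<parallel>\<^sup>2\<close>, and here \<open>\<sigma>\<close> may be the smallest singular value of the
  Jacobian at either of the two points (\<open>sigma_min_dist_le_residual\<close>). The point \<open>y\<close> gives the rate of
  the theorem. That rate depends on \<open>y\<close> and is not known to stay away from 1, because the
  derivative need not be continuous. The point \<open>z\<close> gives a constant \<open>\<sigma>\<close> instead, and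
  \<open>\<parallel>J\<^sub>y\<parallel>\<^sub>F\<close> is bounded on the ball (\<open>Jac_bounded_on_cball\<close>). So the mean squared error also
  decreases by a fixed factor \<open>q < 1\<close> in every step, which yields convergence.
\<close>

section \<open>The smallest nonzero singular value\<close>

lemma norm_sq_cart: "(norm v)\<^sup>2 = (\<Sum>i\<in>UNIV. (v $ i)\<^sup>2)" for v :: "real^'m"
  unfolding power2_norm_eq_inner inner_vec_def by (simp add: power2_eq_square)

lemma frobenius_norm_sq: "(frobenius_norm A)\<^sup>2 = (\<Sum>i\<in>UNIV. (norm (row i A))\<^sup>2)"
  by (simp add: frobenius_norm_def norm_sq_cart row_def sum_nonneg)

lemma norm_row_sq_le_frobenius_norm_sq: "(norm (row i A))\<^sup>2 \<le> (frobenius_norm A)\<^sup>2"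
  unfolding frobenius_norm_sq by (rule member_le_sum) auto

lemma norm_matrix_vector_sq: "(norm (A *v v))\<^sup>2 = (\<Sum>i\<in>UNIV. (row i A \<bullet> v)\<^sup>2)"
  for A :: "real^'n^'m"
  unfolding norm_sq_cart
  by (simp add: matrix_vector_mult_def row_def inner_vec_def)

lemma inner_gram: "((transpose A ** A) *v v) \<bullet> w = (A *v v) \<bullet> (A *v w)"
  for A :: "real^'n^'m"
  by (metis dot_lmul_matrix matrix_vector_mul_assoc vector_transpose_matrix transpose_transpose
      transpose_matrix_vector)

lemma gram_eigenvalue_eq:
  fixes A :: "real^'n^'m"
  assumes "(transpose A ** A) *v v = \<mu> *\<^sub>R v"
  shows "\<mu> * (norm v)\<^sup>2 = (norm (A *v v))\<^sup>2"
  using inner_gram[of A v v] assms by (simp add: power2_norm_eq_inner)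

text \<open>
  The Gram matrix \<open>A\<^sup>T A\<close> is symmetric, so eigenvectors to different eigenvalues are orthogonal, and a
  finite-dimensional space has room for only finitely many of them. Finiteness is what gives the
  minimum in \<open>sigma_min\<close> its meaning.
\<close>

lemma finite_gram_eigenvalues:
  fixes A :: "real^'n^'m"
  shows "finite {\<mu>. \<exists>v. v \<noteq> 0 \<and> (transpose A ** A) *v v = \<mu> *\<^sub>R v}"
proof -
  define E where "E = {\<mu>. \<exists>v. v \<noteq> 0 \<and> (transpose A ** A) *v v = \<mu> *\<^sub>R v}"
  have "\<forall>\<mu>\<in>E. \<exists>v. v \<noteq> 0 \<and> (transpose A ** A) *v v = \<mu> *\<^sub>R v"
    by (simp add: E_def)
  from bchoice[OF this] obtain v
    where nz: "\<And>\<mu>. \<mu> \<in> E \<Longrightarrow> v \<mu> \<noteq> 0"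
      and eig: "\<And>\<mu>. \<mu> \<in> E \<Longrightarrow> (transpose A ** A) *v v \<mu> = \<mu> *\<^sub>R v \<mu>"
    by blast
  have orth: "v \<mu> \<bullet> v \<nu> = 0" if "\<mu> \<in> E" "\<nu> \<in> E" "\<mu> \<noteq> \<nu>" for \<mu> \<nu>
  proof -
    have "\<mu> * (v \<mu> \<bullet> v \<nu>) = (A *v v \<mu>) \<bullet> (A *v v \<nu>)"
      unfolding inner_gram[symmetric] eig[OF that(1)] by simp
    also have "\<dots> = (A *v v \<nu>) \<bullet> (A *v v \<mu>)"
      by (rule inner_commute)
    also have "\<dots> = \<nu> * (v \<mu> \<bullet> v \<nu>)"
      unfolding inner_gram[symmetric] eig[OF that(2)] by (simp add: inner_commute)
    finally show ?thesis using that(3) by simp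
  qed
  have inj: "inj_on v E"
  proof (rule inj_onI, rule ccontr)
    fix \<mu> \<nu> assume "\<mu> \<in> E" "\<nu> \<in> E" "v \<mu> = v \<nu>" "\<mu> \<noteq> \<nu>"
    then show False using orth[of \<mu> \<nu>] nz[of \<nu>] by simp
  qed
  have "pairwise orthogonal (v ` E)"
    using orth by (auto simp: pairwise_def orthogonal_def)
  moreover have "0 \<notin> v ` E" using nz by force
  ultimately have "finite (v ` E)"
    by (intro independent_imp_finite pairwise_orthogonal_independent)
  then have "finite E" using inj by (rule finite_imageD)
  then show ?thesis by (simp add: E_def)
qed

lemma finite_singular_values: "finite (singular_values A)" for A :: "real^'n^'m"
proof -
  have "singular_values A = sqrt ` {\<mu>. \<exists>v. v \<noteq> 0 \<and> (transpose A ** A) *v v = \<mu> *\<^sub>R v}"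
    by (auto simp: singular_values_def)
  then show ?thesis by (simp only: finite_imageI finite_gram_eigenvalues)
qed

lemma singular_value_nonneg: "0 \<le> s" if "s \<in> singular_values A" for A :: "real^'n^'m"
proof -
  from that obtain \<mu> v where s: "s = sqrt \<mu>" and v: "v \<noteq> 0"
    "(transpose A ** A) *v v = \<mu> *\<^sub>R v" unfolding singular_values_def by blast
  have "0 \<le> \<mu> * (norm v)\<^sup>2" using gram_eigenvalue_eq[OF v(2)] by simp
  then show ?thesis using s v(1) by (simp add: zero_le_mult_iff)
qed

text \<open>
  A minimiser \<open>v\<close> of \<open>\<parallel>A v\<parallel>\<^sup>2\<close> on the unit sphere is an eigenvector: the quadratic form
  \<open>\<parallel>A w\<parallel>\<^sup>2 - \<mu> * \<parallel>w\<parallel>\<^sup>2\<close>, with \<open>\<mu>\<close> the minimum, is nonnegative and vanishes at \<open>v\<close>, so its derivative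
  at \<open>v\<close>, which is \<open>2 * (A\<^sup>T A v - \<mu> v)\<close>, must vanish as well. It suffices to look in the direction
  of that vector.
\<close>

lemma least_gram_eigenvalue:
  fixes A :: "real^'n^'m"
  obtains \<mu> v where "v \<noteq> 0" "(transpose A ** A) *v v = \<mu> *\<^sub>R v"
    "\<And>w. \<mu> * (norm w)\<^sup>2 \<le> (norm (A *v w))\<^sup>2"
proof -
  let ?G = "transpose A ** A"
  have "continuous_on (sphere 0 1) (\<lambda>v. (norm (A *v v))\<^sup>2)"
    by (intro continuous_intros linear_continuous_on) (simp add: matrix_vector_mul_bounded_linear)
  moreover have "sphere (0 :: real^'n) 1 \<noteq> {}" by simp
  ultimately obtain v where v: "v \<in> sphere 0 1"
    and least: "\<And>w. w \<in> sphere 0 1 \<Longrightarrow> (norm (A *v v))\<^sup>2 \<le> (norm (A *v w))\<^sup>2"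
    using continuous_attains_inf[OF compact_sphere] by metis
  define \<mu> where "\<mu> = (norm (A *v v))\<^sup>2"
  have bound: "\<mu> * (norm w)\<^sup>2 \<le> (norm (A *v w))\<^sup>2" for w
  proof (cases "w = 0")
    case False
    have "\<mu> \<le> (norm (A *v ((1 / norm w) *\<^sub>R w)))\<^sup>2"
      unfolding \<mu>_def using False by (intro least) simp
    also have "\<dots> = (norm (A *v w))\<^sup>2 / (norm w)\<^sup>2"
      by (simp add: matrix_vector_mult_scaleR power_divide)
    finally show ?thesis using False by (simp add: field_simps)
  qed simp
  define r where "r = ?G *v v - \<mu> *\<^sub>R v"
  define p where "p t = (norm (A *v (v + t *\<^sub>R r)))\<^sup>2 - \<mu> * (norm (v + t *\<^sub>R r))\<^sup>2" for t
  have p0: "p 0 = 0" using v by (simp add: p_def \<mu>_def)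
  have p_eq: "p t = 2 * t * (r \<bullet> r) + t\<^sup>2 * ((norm (A *v r))\<^sup>2 - \<mu> * (norm r)\<^sup>2)" for t
  proof -
    have "(A *v v) \<bullet> (A *v r) = r \<bullet> r + \<mu> * (v \<bullet> r)"
      unfolding r_def by (simp add: inner_diff_left flip: inner_gram)
    then have "p t = p 0 + 2 * t * (r \<bullet> r) + t\<^sup>2 * ((norm (A *v r))\<^sup>2 - \<mu> * (norm r)\<^sup>2)"
      unfolding p_def power2_norm_eq_inner
      by (simp add: matrix_vector_mult_scaleR matrix_vector_right_distrib inner_simps
          inner_commute algebra_simps power2_eq_square)
    with p0 show ?thesis by simp
  qed
  \<comment> \<open>So the slope of \<open>p\<close> at its minimum 0 is twice the squared length of \<open>r\<close>.\<close>
  have "(p has_real_derivative 2 * (r \<bullet> r)) (at 0)"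
    unfolding p_eq by (auto intro!: derivative_eq_intros)
  moreover have "p 0 \<le> p t" for t using p0 bound unfolding p_def by simp
  ultimately have "2 * (r \<bullet> r) = 0"
    by (intro DERIV_local_min[of p _ 0 1]) auto
  then have "?G *v v = \<mu> *\<^sub>R v" by (simp add: r_def)
  with v bound show ?thesis using that[of v \<mu>] by force
qed

text \<open>
  For full column rank the least eigenvalue of \<open>A\<^sup>T A\<close> is positive, hence its root is among the nonzero
  singular values and bounds their minimum from above.
\<close>

lemma
  fixes A :: "real^'n^'m"
  assumes "rank A = CARD('n)"
  shows sigma_min_pos: "0 < sigma_min A"
    and sigma_min_bound: "(sigma_min A)\<^sup>2 * (norm w)\<^sup>2 \<le> (norm (A *v w))\<^sup>2"
proof -
  obtain \<mu> v where v: "v \<noteq> 0" "(transpose A ** A) *v v = \<mu> *\<^sub>R v"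
    and bound: "\<And>w. \<mu> * (norm w)\<^sup>2 \<le> (norm (A *v w))\<^sup>2"
    by (rule least_gram_eigenvalue[of A]) blast
  have "A *v v \<noteq> A *v 0"
    using assms v(1) unfolding full_rank_injective by (metis injD)
  then have "0 < \<mu> * (norm v)\<^sup>2" using gram_eigenvalue_eq[OF v(2)] by simp
  then have \<mu>: "0 < \<mu>" by (simp add: zero_less_mult_iff)
  let ?S = "{s \<in> singular_values A. s \<noteq> 0}"
  have fin: "finite ?S" by (rule finite_subset[OF _ finite_singular_values[of A]]) auto
  have mem: "sqrt \<mu> \<in> ?S" using v \<mu> unfolding singular_values_def by auto
  have "sigma_min A \<in> ?S"
    unfolding sigma_min_def using fin mem by (intro Min_in) auto
  then show pos: "0 < sigma_min A" using singular_value_nonneg[of "sigma_min A" A] by simp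
  have "sigma_min A \<le> sqrt \<mu>" unfolding sigma_min_def using fin mem by (rule Min_le)
  then have "(sigma_min A)\<^sup>2 \<le> \<mu>" using pos \<mu> by (metis less_eq_real_def power_mono real_sqrt_pow2)
  then show "(sigma_min A)\<^sup>2 * (norm w)\<^sup>2 \<le> (norm (A *v w))\<^sup>2"
    using bound[of w] by (meson mult_right_mono order_trans zero_le_power2)
qed

section \<open>Consequences of the tangential cone condition\<close>

lemma local_tangential_coneD:
  assumes "local_tangential_cone D f x0 \<rho> \<eta>" "y \<in> cball x0 \<rho>" "z \<in> cball x0 \<rho>"
  shows "\<bar>f y $ i - f z $ i - grad D f i y \<bullet> (y - z)\<bar> \<le> \<eta> * \<bar>f y $ i - f z $ i\<bar>" "0 \<le> \<eta>" "\<eta> < 1/2"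
proof -
  obtain h where h: "h \<in> {0..\<eta>}"
    "\<bar>f y $ i - f z $ i - grad D f i y \<bullet> (y - z)\<bar> \<le> h * \<bar>f y $ i - f z $ i\<bar>"
    using assms unfolding local_tangential_cone_def by blast
  have "h * \<bar>f y $ i - f z $ i\<bar> \<le> \<eta> * \<bar>f y $ i - f z $ i\<bar>"
    using h(1) by (intro mult_right_mono) auto
  with h show "\<bar>f y $ i - f z $ i - grad D f i y \<bullet> (y - z)\<bar> \<le> \<eta> * \<bar>f y $ i - f z $ i\<bar>" "0 \<le> \<eta>"
    by auto
  show "\<eta> < 1/2" using assms(1) by (simp add: local_tangential_cone_def)
qed

lemma linearization_le:
  assumes "local_tangential_cone D f x0 \<rho> \<eta>" "y \<in> cball x0 \<rho>" "z \<in> cball x0 \<rho>"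
  shows "\<bar>grad D f i y \<bullet> (y - z)\<bar> \<le> (1 + \<eta>) * \<bar>f y $ i - f z $ i\<bar>"
  using local_tangential_coneD(1)[OF assms, of i] by (simp add: distrib_right)

text \<open>
  An error bound: the residual controls the distance. The Jacobian is taken at the first of the two
  points only, so exchanging them moves the singular value to the other one; both forms are used.
\<close>

lemma sigma_min_dist_le_residual:
  fixes f :: "real^'n \<Rightarrow> real^'m"
  assumes tcc: "local_tangential_cone D f x0 \<rho> \<eta>" and y: "y \<in> cball x0 \<rho>" and z: "z \<in> cball x0 \<rho>"
    and rank: "rank (Jac D f y) = CARD('n)"
  shows "(sigma_min (Jac D f y))\<^sup>2 * (norm (y - z))\<^sup>2 \<le> (1 + \<eta>)\<^sup>2 * (norm (f y - f z))\<^sup>2"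
proof -
  have "(sigma_min (Jac D f y))\<^sup>2 * (norm (y - z))\<^sup>2 \<le> (norm (Jac D f y *v (y - z)))\<^sup>2"
    by (rule sigma_min_bound[OF rank])
  also have "\<dots> = (\<Sum>i\<in>UNIV. (grad D f i y \<bullet> (y - z))\<^sup>2)"
    by (rule norm_matrix_vector_sq)
  also have "\<dots> \<le> (\<Sum>i\<in>UNIV. ((1 + \<eta>) * \<bar>f y $ i - f z $ i\<bar>)\<^sup>2)"
    using linearization_le[OF tcc y z] by (intro sum_mono) (metis abs_ge_zero power2_abs power_mono)
  also have "\<dots> = (1 + \<eta>)\<^sup>2 * (norm (f y - f z))\<^sup>2"
    by (simp add: norm_sq_cart power_mult_distrib sum_distrib_left)
  finally show ?thesis .
qed

text \<open>
  The cone condition bounds the increment of the linearisation at \<open>y\<close> to any point of the ball by the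
  oscillation of \<open>f\<close>, which is finite by compactness. For \<open>\<rho> > 0\<close> every gradient is a multiple of
  the difference of two points of the ball, so this bounds the gradients, although \<open>f'\<close> may be discontinuous.
\<close>

lemma Jac_bounded_on_cball:
  fixes f :: "real^'n \<Rightarrow> real^'m"
  assumes tcc: "local_tangential_cone D f x0 \<rho> \<eta>" and cont: "continuous_on (cball x0 \<rho>) f"
  obtains C where "0 < C" "\<And>y. y \<in> cball x0 \<rho> \<Longrightarrow> (frobenius_norm (Jac D f y))\<^sup>2 \<le> C"
proof (cases "0 < \<rho>")
  case False
  then have "y = x0" if "y \<in> cball x0 \<rho>" for y
    using that False zero_le_dist[of x0 y] unfolding mem_cball by (metis dist_le_zero_iff not_less order_trans)
  then show ?thesis
    using that[of "(frobenius_norm (Jac D f x0))\<^sup>2 + 1"] by (force simp: add_nonneg_pos)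
next
  case True
  have "bounded (f ` cball x0 \<rho>)"
    by (intro compact_imp_bounded compact_continuous_image[OF cont] compact_cball)
  then obtain B where "\<And>y. y \<in> cball x0 \<rho> \<Longrightarrow> norm (f y) \<le> B"
    unfolding bounded_iff by blast
  then have B: "\<bar>f y $ i\<bar> \<le> B" if "y \<in> cball x0 \<rho>" for y i
    using that component_le_norm_cart[of "f y" i] by force
  define K where "K = 2 * (1 + \<eta>) * B / \<rho>"
  have bnd: "norm (grad D f i y) \<le> K" if y: "y \<in> cball x0 \<rho>" for y i
  proof -
    define g where "g = grad D f i y"
    have \<eta>: "0 \<le> \<eta>" using local_tangential_coneD(2)[OF tcc y y] .
    \<comment> \<open>Two antipodal points of the sphere, in the direction of the gradient.\<close>
    define a where "a = x0 + \<rho> *\<^sub>R sgn g"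
    define b where "b = x0 - \<rho> *\<^sub>R sgn g"
    have ab: "a \<in> cball x0 \<rho>" "b \<in> cball x0 \<rho>"
      using True by (auto simp: a_def b_def dist_norm norm_sgn)
    have le: "\<bar>g \<bullet> (y - w)\<bar> \<le> (1 + \<eta>) * (2 * B)" if w: "w \<in> cball x0 \<rho>" for w
    proof -
      have "\<bar>g \<bullet> (y - w)\<bar> \<le> (1 + \<eta>) * \<bar>f y $ i - f w $ i\<bar>"
        unfolding g_def by (rule linearization_le[OF tcc y w])
      also have "\<dots> \<le> (1 + \<eta>) * (2 * B)"
        using B[OF y, of i] B[OF w, of i] \<eta> by (intro mult_left_mono) auto
      finally show ?thesis .
    qed
    have "g \<bullet> (y - b) - g \<bullet> (y - a) = 2 * \<rho> * (g \<bullet> sgn g)"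
      by (simp add: a_def b_def inner_simps)
    also have "g \<bullet> sgn g = norm g"
      by (cases "g = 0") (simp_all add: sgn_div_norm power2_norm_eq_inner[symmetric] power2_eq_square)
    finally have "2 * \<rho> * norm g \<le> 4 * ((1 + \<eta>) * B)"
      using le[OF ab(1)] le[OF ab(2)] by (simp add: algebra_simps)
    then show ?thesis using True by (simp add: K_def g_def field_simps)
  qed
  show ?thesis
  proof (rule that[of "real CARD('m) * K\<^sup>2 + 1"])
    show "0 < real CARD('m) * K\<^sup>2 + 1" by (simp add: add_nonneg_pos)
    fix y assume y: "y \<in> cball x0 \<rho>"
    have "(frobenius_norm (Jac D f y))\<^sup>2 \<le> (\<Sum>i\<in>(UNIV::'m set). K\<^sup>2)"
      unfolding frobenius_norm_sq using bnd[OF y] by (intro sum_mono power_mono) auto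
    then show "(frobenius_norm (Jac D f y))\<^sup>2 \<le> real CARD('m) * K\<^sup>2 + 1" by simp
  qed
qed

section \<open>One Kaczmarz step\<close>

definition kaczmarz_step ::
    "(real^'n) set \<Rightarrow> (real^'n \<Rightarrow> real^'m) \<Rightarrow> real^'n \<Rightarrow> 'm \<Rightarrow> real^'n"
  where "kaczmarz_step D f y i =
    y - (f y $ i / (norm (grad D f i y))\<^sup>2) *\<^sub>R grad D f i y"

text \<open>
  Expanding the square, the cross term is \<open>-2 * f\<^sub>i y * \<langle>\<nabla>f\<^sub>i y, y - z\<rangle> / \<parallel>\<nabla>f\<^sub>i y\<parallel>\<^sup>2\<close>. The cone condition with
  \<open>f z = 0\<close> bounds the inner product below, in the direction of \<open>f\<^sub>i y\<close>, by \<open>(1 - \<eta>) * \<bar>f\<^sub>i y\<bar>\<close>; the quadratic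
  term gives back \<open>(f\<^sub>i y)\<^sup>2 / \<parallel>\<nabla>f\<^sub>i y\<parallel>\<^sup>2\<close> once.
\<close>

lemma kaczmarz_step_decrease:
  assumes tcc: "local_tangential_cone D f x0 \<rho> \<eta>" and y: "y \<in> cball x0 \<rho>" and z: "z \<in> cball x0 \<rho>"
    and "f z = 0" and g0: "grad D f i y \<noteq> 0"
  shows "(norm (kaczmarz_step D f y i - z))\<^sup>2
    \<le> (norm (y - z))\<^sup>2 - (1 - 2 * \<eta>) * (f y $ i)\<^sup>2 / (norm (grad D f i y))\<^sup>2"
proof -
  define g where "g = grad D f i y"
  define a where "a = f y $ i"
  define n where "n = (norm g)\<^sup>2"
  have n: "0 < n" using g0 by (simp add: n_def g_def)
  have "\<bar>a - g \<bullet> (y - z)\<bar> \<le> \<eta> * \<bar>a\<bar>"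
    using local_tangential_coneD(1)[OF tcc y z, of i] by (simp add: a_def g_def \<open>f z = 0\<close>)
  then have "\<bar>a\<bar> * \<bar>a - g \<bullet> (y - z)\<bar> \<le> \<bar>a\<bar> * (\<eta> * \<bar>a\<bar>)"
    by (intro mult_left_mono) auto
  moreover have "a * (a - g \<bullet> (y - z)) \<le> \<bar>a\<bar> * \<bar>a - g \<bullet> (y - z)\<bar>"
    by (metis abs_ge_self abs_mult)
  ultimately have inner: "(1 - \<eta>) * a\<^sup>2 \<le> a * (g \<bullet> (y - z))"
    by (simp add: algebra_simps power2_eq_square)
  have "(norm (kaczmarz_step D f y i - z))\<^sup>2 = (norm ((y - z) - (a / n) *\<^sub>R g))\<^sup>2"
    by (simp add: kaczmarz_step_def a_def n_def g_def algebra_simps)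
  also have "\<dots> = (norm (y - z))\<^sup>2 - 2 * (a / n) * (g \<bullet> (y - z)) + (a / n)\<^sup>2 * n"
  proof -
    have "(norm (u - c *\<^sub>R g))\<^sup>2 = (norm u)\<^sup>2 - 2 * c * (g \<bullet> u) + c\<^sup>2 * n" for c u
      unfolding n_def power2_norm_eq_inner
      by (simp add: inner_simps inner_commute algebra_simps power2_eq_square)
    then show ?thesis .
  qed
  also have "\<dots> = (norm (y - z))\<^sup>2 - (2 * (a * (g \<bullet> (y - z))) - a\<^sup>2) / n"
    using n by (simp add: field_simps power2_eq_square)
  also have "\<dots> \<le> (norm (y - z))\<^sup>2 - ((1 - 2 * \<eta>) * a\<^sup>2) / n"
    using inner n by (intro diff_left_mono divide_right_mono) (auto simp: algebra_simps)
  finally show ?thesis by (simp add: a_def n_def g_def)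
qed

lemma sum_squares_le_card_mult_max:
  fixes h :: "'i \<Rightarrow> real"
  assumes "is_arg_max (\<lambda>i. \<bar>h i\<bar>) (\<lambda>i. i \<in> T) i"
  shows "(\<Sum>j\<in>T. (h j)\<^sup>2) \<le> card T * (h i)\<^sup>2"
proof -
  have "(h j)\<^sup>2 \<le> (h i)\<^sup>2" if "j \<in> T" for j
    using assms that by (auto simp: is_arg_max_def not_less abs_le_square_iff)
  then show ?thesis using sum_bounded_above[of T "\<lambda>j. (h j)\<^sup>2" "(h i)\<^sup>2"] by simp
qed

text \<open>
  The right-hand side no longer mentions the selected index and is additive over the sample \<open>T\<close>.
  This makes the conditional expectation computable whatever the tie-breaking rule.
\<close>

lemma max_residual_step_decrease:
  fixes f :: "real^'n \<Rightarrow> real^'m"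
  assumes tcc: "local_tangential_cone D f x0 \<rho> \<eta>" and y: "y \<in> cball x0 \<rho>" and z: "z \<in> cball x0 \<rho>"
    and fz: "f z = 0" and rows: "row_bounded_below (Jac D f y)"
    and i: "is_arg_max (\<lambda>i. \<bar>f y $ i\<bar>) (\<lambda>i. i \<in> T) i"
  shows "(norm (kaczmarz_step D f y i - z))\<^sup>2 \<le> (norm (y - z))\<^sup>2 -
    (\<Sum>j\<in>T. (1 - 2 * \<eta>) / (real (card T) * (frobenius_norm (Jac D f y))\<^sup>2) * (f y $ j)\<^sup>2)"
proof -
  define F where "F = (frobenius_norm (Jac D f y))\<^sup>2"
  define n where "n = (norm (grad D f i y))\<^sup>2"
  have g0: "grad D f i y \<noteq> 0" using rows unfolding row_bounded_below_def
    by (metis norm_zero not_less)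
  then have n: "0 < n" by (simp add: n_def)
  have nF: "n \<le> F" unfolding n_def F_def by (rule norm_row_sq_le_frobenius_norm_sq)
  have T: "0 < card T" using i by (auto simp: is_arg_max_def card_gt_0_iff)
  have \<eta>: "\<eta> < 1/2" using local_tangential_coneD(3)[OF tcc y z] .
  have "(\<Sum>j\<in>T. (1 - 2 * \<eta>) / (card T * F) * (f y $ j)\<^sup>2)
      = (1 - 2 * \<eta>) / (card T * F) * (\<Sum>j\<in>T. (f y $ j)\<^sup>2)"
    by (simp add: sum_distrib_left)
  also have "\<dots> \<le> (1 - 2 * \<eta>) / (card T * F) * (card T * (f y $ i)\<^sup>2)"
    using n nF \<eta> by (intro mult_left_mono sum_squares_le_card_mult_max[OF i]) auto
  also have "\<dots> = (1 - 2 * \<eta>) * (f y $ i)\<^sup>2 / F" using T by (simp del: card_0_eq card_gt_0_iff)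
  also have "\<dots> \<le> (1 - 2 * \<eta>) * (f y $ i)\<^sup>2 / n"
    using n nF \<eta> by (intro divide_left_mono) auto
  finally show ?thesis
    using kaczmarz_step_decrease[OF tcc y z fz g0] by (simp add: n_def F_def)
qed

text \<open>
  The left-hand side is the bound for the conditional mean squared error after one step from \<open>y\<close>.
  The error bound at \<open>y\<close> turns it into the contraction factor that depends on \<open>y\<close>.
\<close>

lemma expected_decrease_le_factor:
  fixes f :: "real^'n \<Rightarrow> real^'m"
  assumes tcc: "local_tangential_cone D f x0 \<rho> \<eta>" and y: "y \<in> cball x0 \<rho>" and z: "z \<in> cball x0 \<rho>"
    and fz: "f z = 0" and rank: "rank (Jac D f y) = CARD('n)"
  shows "(norm (y - z))\<^sup>2 - (1 - 2 * \<eta>) / (CARD('m) * (frobenius_norm (Jac D f y))\<^sup>2) * (norm (f y))\<^sup>2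
    \<le> nskm_factor D f \<eta> y * (norm (y - z))\<^sup>2"
proof -
  let ?s = "(sigma_min (Jac D f y))\<^sup>2" and ?c = "(1 - 2 * \<eta>) / (CARD('m) * (frobenius_norm (Jac D f y))\<^sup>2)"
  have \<eta>: "0 \<le> \<eta>" "\<eta> < 1/2" using local_tangential_coneD(2,3)[OF tcc y z] .
  have "?s * (norm (y - z))\<^sup>2 \<le> (1 + \<eta>)\<^sup>2 * (norm (f y))\<^sup>2"
    using sigma_min_dist_le_residual[OF tcc y z rank] by (simp add: fz)
  then have "?s * (norm (y - z))\<^sup>2 / (1 + \<eta>)\<^sup>2 \<le> (norm (f y))\<^sup>2"
    using \<eta> by (simp add: divide_le_eq mult.commute)
  then have "?c * (?s * (norm (y - z))\<^sup>2 / (1 + \<eta>)\<^sup>2) \<le> ?c * (norm (f y))\<^sup>2"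
    using \<eta> by (intro mult_left_mono) auto
  moreover have "nskm_factor D f \<eta> y * (norm (y - z))\<^sup>2
      = (norm (y - z))\<^sup>2 - ?c * (?s * (norm (y - z))\<^sup>2 / (1 + \<eta>)\<^sup>2)"
  proof -
    have "(1 - a * s / (m * b * F)) * d = d - a / (m * F) * (s * d / b)" for a s m b F d :: real
      by (simp add: algebra_simps)
    then show ?thesis unfolding nskm_factor_def .
  qed
  ultimately show ?thesis by simp
qed

text \<open>
  The error bound with the Jacobian at the solution \<open>z\<close>, together with the bound on the Frobenius
  norms, gives a factor that does not depend on \<open>y\<close>.
\<close>

lemma expected_decrease_uniform:
  fixes f :: "real^'n \<Rightarrow> real^'m"
  assumes tcc: "local_tangential_cone D f x0 \<rho> \<eta>" and cont: "continuous_on (cball x0 \<rho>) f"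
    and z: "z \<in> cball x0 \<rho>" and fz: "f z = 0" and rank: "rank (Jac D f z) = CARD('n)"
    and rows: "\<And>y. y \<in> cball x0 \<rho> \<Longrightarrow> row_bounded_below (Jac D f y)"
  obtains q where "0 \<le> q" "q < 1"
    "\<And>y. y \<in> cball x0 \<rho> \<Longrightarrow>
      (norm (y - z))\<^sup>2 - (1 - 2 * \<eta>) / (CARD('m) * (frobenius_norm (Jac D f y))\<^sup>2) * (norm (f y))\<^sup>2
      \<le> q * (norm (y - z))\<^sup>2"
proof -
  have \<eta>: "0 \<le> \<eta>" "\<eta> < 1/2" using local_tangential_coneD(2,3)[OF tcc z z] .
  obtain C where C: "0 < C" "\<And>y. y \<in> cball x0 \<rho> \<Longrightarrow> (frobenius_norm (Jac D f y))\<^sup>2 \<le> C"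
    using Jac_bounded_on_cball[OF tcc cont] by blast
  define s where "s = (sigma_min (Jac D f z))\<^sup>2 / (1 + \<eta>)\<^sup>2"
  have s: "0 < s" using sigma_min_pos[OF rank] \<eta> by (simp add: s_def)
  define p where "p = (1 - 2 * \<eta>) / (CARD('m) * C) * s"
  have p: "0 < p" using \<eta> C s by (simp add: p_def)
  \<comment> \<open>A nonnegative factor allows the inequalities of successive steps to be multiplied.\<close>
  show ?thesis
  proof (rule that[of "max 0 (1 - p)"])
    show "0 \<le> max 0 (1 - p)" "max 0 (1 - p) < 1" using p by auto
    fix y assume y: "y \<in> cball x0 \<rho>"
    let ?F = "(frobenius_norm (Jac D f y))\<^sup>2"
    have F: "0 < ?F"
    proof -
      obtain \<epsilon> where "0 < \<epsilon>" "\<And>i. \<epsilon> \<le> norm (grad D f i y)"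
        using rows[OF y] unfolding row_bounded_below_def by blast
      \<comment> \<open>Any row will do; \<open>undefined\<close> is some index.\<close>
      then have "0 < (norm (grad D f undefined y))\<^sup>2"
        by (metis less_le_trans zero_less_power)
      then show ?thesis using norm_row_sq_le_frobenius_norm_sq by (rule less_le_trans)
    qed
    have "(sigma_min (Jac D f z))\<^sup>2 * (norm (y - z))\<^sup>2 \<le> (1 + \<eta>)\<^sup>2 * (norm (f y))\<^sup>2"
      using sigma_min_dist_le_residual[OF tcc z y rank] by (simp add: fz norm_minus_commute)
    then have "s * (norm (y - z))\<^sup>2 \<le> (norm (f y))\<^sup>2"
      using \<eta> by (simp add: s_def divide_le_eq mult.commute)
    then have "(1 - 2 * \<eta>) / (CARD('m) * C) * (s * (norm (y - z))\<^sup>2)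
        \<le> (1 - 2 * \<eta>) / (CARD('m) * ?F) * (norm (f y))\<^sup>2"
      using \<eta> F C(1) C(2)[OF y] s by (intro mult_mono divide_left_mono mult_left_mono) auto
    then have "(norm (y - z))\<^sup>2 - (1 - 2 * \<eta>) / (CARD('m) * ?F) * (norm (f y))\<^sup>2
        \<le> (1 - p) * (norm (y - z))\<^sup>2"
      unfolding p_def left_diff_distrib[of 1] by (simp only: mult_1 mult.assoc diff_left_mono)
    also have "\<dots> \<le> max 0 (1 - p) * (norm (y - z))\<^sup>2"
      by (intro mult_right_mono) auto
    finally show "(norm (y - z))\<^sup>2 - (1 - 2 * \<eta>) / (CARD('m) * ?F) * (norm (f y))\<^sup>2
        \<le> max 0 (1 - p) * (norm (y - z))\<^sup>2" .
  qed
qed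

section \<open>Conditioning on the history\<close>

lemma (in prob_space) real_cond_exp_indicator_indep:
  assumes "subalgebra M F" and A: "A \<in> events"
    and indep: "\<And>B. B \<in> sets F \<Longrightarrow> prob (A \<inter> B) = prob A * prob B"
  shows "AE \<omega> in M. real_cond_exp M F (indicator A) \<omega> = prob A"
proof -
  interpret finite_measure_subalgebra M F
    using assms(1) by unfold_locales
  show ?thesis
  proof (rule real_cond_exp_charact)
    fix B assume B: "B \<in> sets F"
    then have B': "B \<in> events" using assms(1) by (auto simp: subalgebra_def)
    have "(\<integral>\<omega>\<in>B. indicator A \<omega> \<partial>M) = (\<integral>\<omega>. indicator (A \<inter> B) \<omega> \<partial>M)"
      unfolding set_lebesgue_integral_def
      by (intro Bochner_Integration.integral_cong) (auto simp: indicator_def)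
    also have "\<dots> = prob A * prob B"
      using indep[OF B] A B' by simp
    also have "\<dots> = (\<integral>\<omega>\<in>B. prob A \<partial>M)"
      using B' by (simp add: set_lebesgue_integral_def)
    finally show "(\<integral>\<omega>\<in>B. indicator A \<omega> \<partial>M) = (\<integral>\<omega>\<in>B. prob A \<partial>M)" .
  qed (use A in \<open>auto simp: integrable_indicator_iff less_top[symmetric]\<close>)
qed

text \<open>
  Of the \<open>m choose \<beta>\<close> sets, those containing \<open>i\<close> number \<open>(m - 1) choose (\<beta> - 1)\<close>: they are what is left
  after removing the subsets of the other \<open>m - 1\<close> points.
\<close>

lemma prob_mem_uniform_subset:
  fixes i :: "'m::finite"
  assumes \<beta>: "\<beta> \<in> {1..CARD('m)}"
  shows "measure (measure_pmf (pmf_of_set {T :: 'm set. card T = \<beta>})) {T. i \<in> T} = \<beta> / CARD('m)"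
proof -
  let ?m = "CARD('m)" and ?S = "{T :: 'm set. card T = \<beta>}"
  have card_S: "card ?S = ?m choose \<beta>"
    using n_subsets[of "UNIV :: 'm set" \<beta>] by simp
  have "card {T \<in> ?S. i \<notin> T} = (?m - 1) choose \<beta>"
  proof -
    have "{T \<in> ?S. i \<notin> T} = {T. T \<subseteq> UNIV - {i} \<and> card T = \<beta>}" by auto
    then show ?thesis using n_subsets[of "UNIV - {i}" \<beta>] by (simp add: card_Diff_singleton)
  qed
  moreover have "card ?S = card (?S \<inter> {T. i \<in> T}) + card {T \<in> ?S. i \<notin> T}"
    by (subst card_Un_disjoint[symmetric]) (auto intro!: arg_cong[of _ _ card])
  moreover have "?m choose \<beta> = ((?m - 1) choose (\<beta> - 1)) + ((?m - 1) choose \<beta>)"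
    using \<beta> by (subst choose_reduce_nat) auto
  ultimately have card_i: "card (?S \<inter> {T. i \<in> T}) = (?m - 1) choose (\<beta> - 1)"
    using card_S by simp
  have "\<beta> * (?m choose \<beta>) = ?m * ((?m - 1) choose (\<beta> - 1))"
    using \<beta> by (intro times_binomial_minus1_eq) auto
  then have "real \<beta> * real (?m choose \<beta>) = real ?m * real ((?m - 1) choose (\<beta> - 1))"
    by (metis of_nat_mult)
  moreover have pos: "0 < ?m choose \<beta>" using \<beta> by simp
  moreover have "?S \<noteq> {}" using pos card_S by (metis card.empty less_irrefl)
  ultimately show ?thesis
    using card_S card_i by (simp add: measure_pmf_of_set field_simps)
qed

locale nskm_run =
  fixes M :: "'w measure" and D :: "(real^'n) set" and f :: "real^'n \<Rightarrow> real^'m"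
    and \<beta> :: nat and x0 :: "real^'n"
    and \<tau> :: "nat \<Rightarrow> 'w \<Rightarrow> 'm set" and \<iota> :: "nat \<Rightarrow> 'w \<Rightarrow> 'm" and x :: "nat \<Rightarrow> 'w \<Rightarrow> real^'n"
  assumes run: "nskm M D f \<beta> x0 \<tau> \<iota> x" and \<beta>: "\<beta> \<in> {1..CARD('m)}"
begin

sublocale prob_space M
  using run by (simp add: nskm_def)

abbreviation H :: "nat \<Rightarrow> 'w measure"
  where "H k \<equiv> history_algebra M \<tau> \<iota> k"

lemma sample_measurable: "1 \<le> k \<Longrightarrow> \<tau> k \<in> measurable M (count_space UNIV)"
  and index_measurable: "1 \<le> k \<Longrightarrow> \<iota> k \<in> measurable M (count_space UNIV)"
  and sample_distr: "1 \<le> k \<Longrightarrow>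
    distr M (count_space UNIV) (\<tau> k) = measure_pmf (pmf_of_set {T. card T = \<beta>})"
  and sample_indep: "1 \<le> k \<Longrightarrow>
    indep_set (sets (vimage_algebra (space M) (\<tau> k) (count_space UNIV))) (sets (H k))"
  using run unfolding nskm_def by blast+

lemma start: "\<omega> \<in> space M \<Longrightarrow> x 0 \<omega> = x0"
  and selection: "\<omega> \<in> space M \<Longrightarrow> 1 \<le> k \<Longrightarrow>
    is_arg_max (\<lambda>i. \<bar>f (x (k - 1) \<omega>) $ i\<bar>) (\<lambda>i. i \<in> \<tau> k \<omega>) (\<iota> k \<omega>)"
  and step: "\<omega> \<in> space M \<Longrightarrow> 1 \<le> k \<Longrightarrow> x k \<omega> = kaczmarz_step D f (x (k - 1) \<omega>) (\<iota> k \<omega>)"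
  using run unfolding nskm_def kaczmarz_step_def by blast+

lemma history_measurable: "history \<tau> \<iota> k \<in> measurable M (count_space UNIV)"
proof (induction k)
  case 0
  show ?case by (simp add: history_def)
next
  case (Suc k)
  show ?case
  proof (cases "1 \<le> k")
    case False
    then show ?thesis by (simp add: history_def)
  next
    case True
    have "history \<tau> \<iota> (Suc k) = (\<lambda>\<omega>. history \<tau> \<iota> k \<omega> @ [(\<tau> k \<omega>, \<iota> k \<omega>)])"
      using True by (simp add: history_def fun_eq_iff)
    moreover have "(\<lambda>\<omega>. history \<tau> \<iota> k \<omega> @ [(\<tau> k \<omega>, \<iota> k \<omega>)]) \<in> measurable M (count_space UNIV)"
      by (rule measurable_compose_countable[OF measurable_compose_countable
            [OF measurable_compose[OF Suc.IH] sample_measurable[OF True]] index_measurable[OF True]])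
        simp
    ultimately show ?thesis by simp
  qed
qed

lemma subalgebra_H: "subalgebra M (H k)"
  using measurable_sets[OF history_measurable, of _ k]
  by (auto simp: subalgebra_def history_algebra_def sets_vimage_algebra2)

text \<open>
  The history takes only finitely many values, so any real function of it is bounded and measurable.
  This covers every function of an iterate, such as the contraction factor, whose dependence on the
  iterate may be arbitrarily irregular.
\<close>

lemma history_fun:
  fixes \<phi> :: "_ \<Rightarrow> real"
  shows measurable_history_fun: "(\<lambda>\<omega>. \<phi> (history \<tau> \<iota> k \<omega>)) \<in> borel_measurable (H k)"
    and integrable_history_fun: "integrable M (\<lambda>\<omega>. \<phi> (history \<tau> \<iota> k \<omega>))"
proof -
  have "history \<tau> \<iota> k \<in> measurable (H k) (count_space UNIV)"
    unfolding history_algebra_def by (rule measurable_vimage_algebra1) simp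
  then show *: "(\<lambda>\<omega>. \<phi> (history \<tau> \<iota> k \<omega>)) \<in> borel_measurable (H k)"
    by (rule measurable_compose) simp
  let ?L = "{h :: ('m set \<times> 'm) list. set h \<subseteq> UNIV \<and> length h = k - 1}"
  have fin: "finite ?L" by (rule finite_lists_length_eq) simp
  have "history \<tau> \<iota> k \<omega> \<in> ?L" for \<omega> by (simp add: history_def)
  then have "\<bar>\<phi> (history \<tau> \<iota> k \<omega>)\<bar> \<le> Max ((\<lambda>h. \<bar>\<phi> h\<bar>) ` ?L)" for \<omega>
    using fin by (intro Max_ge) auto
  then show "integrable M (\<lambda>\<omega>. \<phi> (history \<tau> \<iota> k \<omega>))"
    by (intro integrable_const_bound[of _ "Max ((\<lambda>h. \<bar>\<phi> h\<bar>) ` ?L)"]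
        measurable_from_subalg[OF subalgebra_H *]) auto
qed

definition iterate :: "('m set \<times> 'm) list \<Rightarrow> real^'n"
  where "iterate h = foldl (kaczmarz_step D f) x0 (map snd h)"

lemma iterate_history: "\<omega> \<in> space M \<Longrightarrow> x k \<omega> = iterate (history \<tau> \<iota> (Suc k) \<omega>)"
proof (induction k)
  case 0
  then show ?case by (simp add: start iterate_def history_def)
next
  case (Suc k)
  then show ?case by (simp add: step[of \<omega> "Suc k"] iterate_def history_def)
qed

lemma iterate_fun:
  fixes \<phi> :: "_ \<Rightarrow> real"
  shows measurable_iterate_fun: "(\<lambda>\<omega>. \<phi> (x k \<omega>)) \<in> borel_measurable (H (Suc k))"
    and integrable_iterate_fun: "integrable M (\<lambda>\<omega>. \<phi> (x k \<omega>))"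
proof -
  have sp: "space (H (Suc k)) = space M" using subalgebra_H by (simp add: subalgebra_def)
  show "(\<lambda>\<omega>. \<phi> (x k \<omega>)) \<in> borel_measurable (H (Suc k))"
    using measurable_history_fun[of "\<lambda>h. \<phi> (iterate h)" "Suc k"]
    by (subst measurable_cong[of _ _ "\<lambda>\<omega>. \<phi> (iterate (history \<tau> \<iota> (Suc k) \<omega>))"])
      (simp_all add: sp iterate_history)
  show "integrable M (\<lambda>\<omega>. \<phi> (x k \<omega>))"
    using integrable_history_fun[of "\<lambda>h. \<phi> (iterate h)" "Suc k"]
    by (subst Bochner_Integration.integrable_cong[OF refl, of _ _ "\<lambda>\<omega>. \<phi> (iterate (history \<tau> \<iota> (Suc k) \<omega>))"])
      (simp_all add: iterate_history)
qed

lemma cond_exp_sampled: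
  assumes k: "1 \<le> k"
  shows "AE \<omega> in M. real_cond_exp M (H k) (indicator {\<omega> \<in> space M. i \<in> \<tau> k \<omega>}) \<omega> = \<beta> / CARD('m)"
proof -
  let ?A = "{\<omega> \<in> space M. i \<in> \<tau> k \<omega>}"
  have vim: "?A = \<tau> k -` {T. i \<in> T} \<inter> space M" by auto
  have A: "?A \<in> events"
    unfolding vim by (rule measurable_sets[OF sample_measurable[OF k]]) simp
  have "prob ?A = measure (distr M (count_space UNIV) (\<tau> k)) {T. i \<in> T}"
    unfolding vim by (rule measure_distr[OF sample_measurable[OF k], symmetric]) simp
  also have "\<dots> = \<beta> / CARD('m)"
    unfolding sample_distr[OF k] by (rule prob_mem_uniform_subset[OF \<beta>])
  finally have prob: "prob ?A = \<beta> / CARD('m)" .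
  have "?A \<in> sets (vimage_algebra (space M) (\<tau> k) (count_space UNIV))"
    unfolding vim by (rule in_vimage_algebra) simp
  then have "prob (?A \<inter> B) = prob ?A * prob B" if "B \<in> sets (H k)" for B
    using indep_setD[OF sample_indep[OF k]] that by blast
  from real_cond_exp_indicator_indep[OF subalgebra_H A this] show ?thesis
    unfolding prob .
qed

text \<open>
  The sum over the sample is the sum over all \<open>i\<close> of a function of the current iterate times the
  indicator that \<open>i\<close> is sampled. The function is known from the history; the indicator is independent
  of the history.
\<close>

lemma cond_exp_sample_sum:
  fixes \<phi> :: "real^'n \<Rightarrow> 'm \<Rightarrow> real"
  assumes k: "1 \<le> k"
  shows "integrable M (\<lambda>\<omega>. \<Sum>i\<in>\<tau> k \<omega>. \<phi> (x (k - 1) \<omega>) i)"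
    and "AE \<omega> in M. real_cond_exp M (H k) (\<lambda>\<omega>. \<Sum>i\<in>\<tau> k \<omega>. \<phi> (x (k - 1) \<omega>) i) \<omega>
      = \<beta> / CARD('m) * (\<Sum>i\<in>UNIV. \<phi> (x (k - 1) \<omega>) i)"
proof -
  interpret finite_measure_subalgebra M "H k"
    using subalgebra_H by unfold_locales
  define A where "A i = {\<omega> \<in> space M. i \<in> \<tau> k \<omega>}" for i
  have A: "A i \<in> events" for i
  proof -
    have "A i = \<tau> k -` {T. i \<in> T} \<inter> space M" by (auto simp: A_def)
    then show ?thesis using measurable_sets[OF sample_measurable[OF k], of "{T. i \<in> T}"] by simp
  qed
  have "Suc (k - 1) = k" using k by simp
  then have meas: "(\<lambda>\<omega>. \<phi> (x (k - 1) \<omega>) i) \<in> borel_measurable (H k)" for i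
    using measurable_iterate_fun[of "\<lambda>y. \<phi> y i" "k - 1"] by simp
  have int: "integrable M (\<lambda>\<omega>. \<phi> (x (k - 1) \<omega>) i * indicator (A i) \<omega>)" for i
    using A by (intro integrable_real_mult_indicator integrable_iterate_fun)
  have eq: "(\<Sum>i\<in>\<tau> k \<omega>. \<phi> (x (k - 1) \<omega>) i) = (\<Sum>i\<in>UNIV. \<phi> (x (k - 1) \<omega>) i * indicator (A i) \<omega>)"
    if "\<omega> \<in> space M" for \<omega>
    using that by (intro sum.mono_neutral_cong_left) (auto simp: A_def)
  let ?S = "\<lambda>\<omega>. \<Sum>i\<in>UNIV. \<phi> (x (k - 1) \<omega>) i * indicator (A i) \<omega>"
  have int_sum: "integrable M ?S" using int by (rule Bochner_Integration.integrable_sum)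
  then show "integrable M (\<lambda>\<omega>. \<Sum>i\<in>\<tau> k \<omega>. \<phi> (x (k - 1) \<omega>) i)"
    using eq by (subst Bochner_Integration.integrable_cong[OF refl]) auto
  then have "AE \<omega> in M. real_cond_exp M (H k) (\<lambda>\<omega>. \<Sum>i\<in>\<tau> k \<omega>. \<phi> (x (k - 1) \<omega>) i) \<omega>
      = real_cond_exp M (H k) ?S \<omega>"
    using eq int_sum by (intro real_cond_exp_cong) auto
  moreover have "AE \<omega> in M. real_cond_exp M (H k) ?S \<omega>
      = (\<Sum>i\<in>UNIV. real_cond_exp M (H k) (\<lambda>\<omega>. \<phi> (x (k - 1) \<omega>) i * indicator (A i) \<omega>) \<omega>)"
    using int by (rule real_cond_exp_sum)
  moreover have "AE \<omega> in M. \<forall>i\<in>UNIV.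
      real_cond_exp M (H k) (\<lambda>\<omega>. \<phi> (x (k - 1) \<omega>) i * indicator (A i) \<omega>) \<omega>
      = \<phi> (x (k - 1) \<omega>) i * real_cond_exp M (H k) (indicator (A i)) \<omega>"
    using meas A int by (intro AE_finite_allI real_cond_exp_mult) auto
  moreover have "AE \<omega> in M. \<forall>i\<in>UNIV. real_cond_exp M (H k) (indicator (A i)) \<omega> = \<beta> / CARD('m)"
    unfolding A_def using cond_exp_sampled[OF k] by (intro AE_finite_allI) auto
  ultimately show "AE \<omega> in M. real_cond_exp M (H k) (\<lambda>\<omega>. \<Sum>i\<in>\<tau> k \<omega>. \<phi> (x (k - 1) \<omega>) i) \<omega>
      = \<beta> / CARD('m) * (\<Sum>i\<in>UNIV. \<phi> (x (k - 1) \<omega>) i)"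
    by eventually_elim (simp add: sum_distrib_left mult.commute)
qed

lemma sample_card:
  assumes k: "1 \<le> k"
  shows "AE \<omega> in M. card (\<tau> k \<omega>) = \<beta>"
proof -
  have "0 < CARD('m) choose \<beta>" using \<beta> by simp
  then have "{T :: 'm set. card T = \<beta>} \<noteq> {}"
    using n_subsets[of "UNIV :: 'm set" \<beta>] by (metis (no_types, lifting) card.empty finite less_irrefl top_greatest Collect_cong)
  then have "AE T in distr M (count_space UNIV) (\<tau> k). card T = \<beta>"
    unfolding sample_distr[OF k] by (simp add: AE_measure_pmf_iff)
  then show ?thesis
    by (subst (asm) AE_distr_iff[OF sample_measurable[OF k]]) simp_all
qed

end

section \<open>Contraction in expectation\<close>

locale nskm_solution = nskm_run M D f \<beta> x0 \<tau> \<iota> x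
  for M :: "'w measure" and D :: "(real^'n) set" and f :: "real^'n \<Rightarrow> real^'m"
    and \<beta> :: nat and x0 :: "real^'n"
    and \<tau> :: "nat \<Rightarrow> 'w \<Rightarrow> 'm set" and \<iota> :: "nat \<Rightarrow> 'w \<Rightarrow> 'm" and x :: "nat \<Rightarrow> 'w \<Rightarrow> real^'n" +
  fixes \<rho> \<eta> :: real and z :: "real^'n"
  assumes tcc: "local_tangential_cone D f x0 \<rho> \<eta>"
    and rows: "\<And>y. y \<in> cball x0 \<rho> \<Longrightarrow> row_bounded_below (Jac D f y)"
    and z_half: "z \<in> cball x0 (\<rho>/2)" and fz: "f z = 0"
begin

lemma half_ball: "dist y z \<le> \<rho>/2 \<Longrightarrow> y \<in> cball x0 \<rho>"
  using z_half dist_triangle[of x0 y z] by (simp add: dist_commute)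

lemma z_ball: "z \<in> cball x0 \<rho>"
  using z_half zero_le_dist[of x0 z] unfolding mem_cball by linarith

lemma \<eta>: "0 \<le> \<eta>" "\<eta> < 1/2"
  using local_tangential_coneD(2,3)[OF tcc z_ball z_ball] .

lemma step_decrease:
  assumes "\<omega> \<in> space M" "1 \<le> k" and y: "x (k - 1) \<omega> \<in> cball x0 \<rho>"
  shows "(norm (x k \<omega> - z))\<^sup>2 \<le> (norm (x (k - 1) \<omega> - z))\<^sup>2 -
    (\<Sum>i\<in>\<tau> k \<omega>. (1 - 2 * \<eta>) / (card (\<tau> k \<omega>) * (frobenius_norm (Jac D f (x (k - 1) \<omega>)))\<^sup>2)
      * (f (x (k - 1) \<omega>) $ i)\<^sup>2)"
  unfolding step[OF assms(1,2)]
  by (rule max_residual_step_decrease[OF tcc y z_ball fz rows[OF y] selection[OF assms(1,2)]])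

text \<open>
  The error never increases, and an error of at most \<open>\<rho>/2\<close> from \<open>z\<close> keeps the iterate inside the ball
  of radius \<open>\<rho>\<close> about \<open>x0\<close>, which is needed to apply the decrease in the next step.
\<close>

lemma iterate_near_solution: "\<omega> \<in> space M \<Longrightarrow> dist (x k \<omega>) z \<le> \<rho>/2"
proof (induction k)
  case 0
  then show ?case using z_half by (simp add: start)
next
  case (Suc k)
  have "0 \<le> (\<Sum>i\<in>\<tau> (Suc k) \<omega>. (1 - 2 * \<eta>) / (card (\<tau> (Suc k) \<omega>) * (frobenius_norm (Jac D f (x k \<omega>)))\<^sup>2)
      * (f (x k \<omega>) $ i)\<^sup>2)"
    using \<eta> by (intro sum_nonneg) auto
  then have "(norm (x (Suc k) \<omega> - z))\<^sup>2 \<le> (norm (x k \<omega> - z))\<^sup>2"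
    using step_decrease[OF Suc.prems, of "Suc k"] half_ball[OF Suc.IH[OF Suc.prems]]
    unfolding diff_Suc_1 by linarith
  then have "norm (x (Suc k) \<omega> - z) \<le> norm (x k \<omega> - z)"
    by (rule power2_le_imp_le) simp
  then show ?case using Suc.IH[OF Suc.prems] by (simp add: dist_norm)
qed

lemma iterate_in_ball: "\<omega> \<in> space M \<Longrightarrow> x k \<omega> \<in> cball x0 \<rho>"
  by (rule half_ball[OF iterate_near_solution])

lemma integrable_error: "integrable M (\<lambda>\<omega>. (norm (x k \<omega> - z))\<^sup>2)"
  by (rule integrable_iterate_fun)

definition expected_decrease_bound :: "real^'n \<Rightarrow> real"
  where "expected_decrease_bound y = (norm (y - z))\<^sup>2 -
    (1 - 2 * \<eta>) / (CARD('m) * (frobenius_norm (Jac D f y))\<^sup>2) * (norm (f y))\<^sup>2"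

lemma cond_exp_error_le:
  assumes k: "1 \<le> k"
  shows "AE \<omega> in M. real_cond_exp M (H k) (\<lambda>\<omega>. (norm (x k \<omega> - z))\<^sup>2) \<omega>
    \<le> expected_decrease_bound (x (k - 1) \<omega>)"
proof -
  interpret finite_measure_subalgebra M "H k"
    using subalgebra_H by unfold_locales
  define \<phi> where "\<phi> y i = (1 - 2 * \<eta>) / (\<beta> * (frobenius_norm (Jac D f y))\<^sup>2) * (f y $ i)\<^sup>2" for y i
  have scale: "\<beta> / CARD('m) * (\<Sum>i\<in>UNIV. \<phi> y i)
      = (1 - 2 * \<eta>) / (CARD('m) * (frobenius_norm (Jac D f y))\<^sup>2) * (norm (f y))\<^sup>2" for y
    unfolding \<phi>_def norm_sq_cart sum_distrib_left[symmetric] using \<beta> by simp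
  let ?e = "\<lambda>\<omega>. (norm (x (k - 1) \<omega> - z))\<^sup>2" and ?S = "\<lambda>\<omega>. \<Sum>i\<in>\<tau> k \<omega>. \<phi> (x (k - 1) \<omega>) i"
  have intS: "integrable M ?S" using cond_exp_sample_sum(1)[OF k, of \<phi>] .
  have "Suc (k - 1) = k" using k by simp
  then have meas: "?e \<in> borel_measurable (H k)"
    using measurable_iterate_fun[of "\<lambda>y. (norm (y - z))\<^sup>2" "k - 1"] by simp
  have "AE \<omega> in M. (norm (x k \<omega> - z))\<^sup>2 \<le> ?e \<omega> - ?S \<omega>"
    using sample_card[OF k] AE_space
  proof eventually_elim
    case (elim \<omega>)
    then show ?case using step_decrease[OF elim(2) k iterate_in_ball[OF elim(2)]] by (simp add: \<phi>_def)
  qed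
  then have "AE \<omega> in M. real_cond_exp M (H k) (\<lambda>\<omega>. (norm (x k \<omega> - z))\<^sup>2) \<omega>
      \<le> real_cond_exp M (H k) (\<lambda>\<omega>. ?e \<omega> - ?S \<omega>) \<omega>"
    by (rule real_cond_exp_mono) (intro integrable_error Bochner_Integration.integrable_diff intS)+
  moreover have "AE \<omega> in M. real_cond_exp M (H k) (\<lambda>\<omega>. ?e \<omega> - ?S \<omega>) \<omega>
      = real_cond_exp M (H k) ?e \<omega> - real_cond_exp M (H k) ?S \<omega>"
    by (rule real_cond_exp_diff[OF integrable_error intS])
  moreover have "AE \<omega> in M. real_cond_exp M (H k) ?e \<omega> = ?e \<omega>"
    by (rule real_cond_exp_F_meas[OF integrable_error meas])
  moreover note cond_exp_sample_sum(2)[OF k, of \<phi>]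
  ultimately show ?thesis
    unfolding expected_decrease_bound_def scale[symmetric] by eventually_elim linarith
qed

text \<open>
  Stated for any majorant \<open>g\<close>, since it is applied both to the factor of the theorem and to the uniform
  one.
\<close>

lemma expectation_error_le:
  assumes k: "1 \<le> k"
    and g: "\<And>y. y \<in> cball x0 \<rho> \<Longrightarrow> expected_decrease_bound y \<le> g y"
  shows "(\<integral>\<omega>. (norm (x k \<omega> - z))\<^sup>2 \<partial>M) \<le> (\<integral>\<omega>. g (x (k - 1) \<omega>) \<partial>M)"
proof -
  interpret finite_measure_subalgebra M "H k"
    using subalgebra_H by unfold_locales
  have "(\<integral>\<omega>. (norm (x k \<omega> - z))\<^sup>2 \<partial>M)
      = (\<integral>\<omega>. real_cond_exp M (H k) (\<lambda>\<omega>. (norm (x k \<omega> - z))\<^sup>2) \<omega> \<partial>M)"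
    by (rule real_cond_exp_int(2)[OF integrable_error, symmetric])
  also have "\<dots> \<le> (\<integral>\<omega>. g (x (k - 1) \<omega>) \<partial>M)"
  proof (rule integral_mono_AE)
    show "AE \<omega> in M. real_cond_exp M (H k) (\<lambda>\<omega>. (norm (x k \<omega> - z))\<^sup>2) \<omega> \<le> g (x (k - 1) \<omega>)"
      using cond_exp_error_le[OF k] AE_space
      by eventually_elim (use g iterate_in_ball in \<open>blast intro: order_trans\<close>)
  qed (intro real_cond_exp_int(1) integrable_error integrable_iterate_fun)+
  finally show ?thesis .
qed

lemma converges:
  assumes cont: "continuous_on (cball x0 \<rho>) f" and rank: "rank (Jac D f z) = CARD('n)"
  shows "converges_in_expectation M x z"
proof -
  obtain q where q: "0 \<le> q" "q < 1"
    "\<And>y. y \<in> cball x0 \<rho> \<Longrightarrow> expected_decrease_bound y \<le> q * (norm (y - z))\<^sup>2"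
    using expected_decrease_uniform[OF tcc cont z_ball fz rank rows]
    unfolding expected_decrease_bound_def by blast
  define E where "E k = (\<integral>\<omega>. (norm (x k \<omega> - z))\<^sup>2 \<partial>M)" for k
  have "E (Suc k) \<le> q * E k" for k
    using expectation_error_le[of "Suc k", OF _ q(3)] by (simp add: E_def)
  then have le: "E k \<le> q ^ k * E 0" for k
  proof (induction k)
    case (Suc k)
    have "E (Suc k) \<le> q * (q ^ k * E 0)"
      using Suc q(1) by (meson mult_left_mono order_trans)
    then show ?case by (simp add: mult.assoc)
  qed simp
  have "(\<lambda>k. q ^ k * E 0) \<longlonglongrightarrow> 0"
    using q by (intro tendsto_mult_left_zero LIMSEQ_power_zero) auto
  then have "E \<longlonglongrightarrow> 0"
    by (rule tendsto_sandwich[OF _ _ tendsto_const, rotated -1])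
      (use le in \<open>auto simp: E_def intro!: always_eventually\<close>)
  then show ?thesis
    unfolding converges_in_expectation_def E_def using integrable_error by blast
qed

end


theorem theorem1:
  fixes f :: "real^'n \<Rightarrow> real^'m" and D :: "(real^'n) set" and x0 :: "real^'n"
    and \<rho> \<eta> :: real and \<beta> :: nat
    and M :: "'w measure" and \<tau> :: "nat \<Rightarrow> 'w \<Rightarrow> 'm set" and \<iota> :: "nat \<Rightarrow> 'w \<Rightarrow> 'm"
    and x :: "nat \<Rightarrow> 'w \<Rightarrow> real^'n"
  assumes "x0 \<in> D"
    and "f differentiable_on D"
    and "local_tangential_cone D f x0 \<rho> \<eta>"
    and "\<forall>y\<in>D. row_bounded_below (Jac D f y) \<and> rank (Jac D f y) = CARD('n)"
    and "\<exists>z\<in>cball x0 (\<rho>/2). f z = 0"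
    and "\<beta> \<in> {1..CARD('m)}"
    and "nskm M D f \<beta> x0 \<tau> \<iota> x"
  shows "\<exists>xs\<in>cball x0 (\<rho>/2). f xs = 0 \<and>
    converges_in_expectation M x xs \<and>
    (\<forall>k\<ge>1.
      (AE \<omega> in M.
        real_cond_exp M (history_algebra M \<tau> \<iota> k) (\<lambda>\<omega>. (norm (x k \<omega> - xs))\<^sup>2) \<omega>
        \<le> nskm_factor D f \<eta> (x (k - 1) \<omega>) *
          real_cond_exp M (history_algebra M \<tau> \<iota> k) (\<lambda>\<omega>. (norm (x (k - 1) \<omega> - xs))\<^sup>2) \<omega>) \<and>
      (\<integral>\<omega>. (norm (x k \<omega> - xs))\<^sup>2 \<partial>M)
        \<le> (\<integral>\<omega>. nskm_factor D f \<eta> (x (k - 1) \<omega>) * (norm (x (k - 1) \<omega> - xs))\<^sup>2 \<partial>M))"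
proof -
  from assms(5) obtain z where z: "z \<in> cball x0 (\<rho>/2)" "f z = 0" by blast
  have sub: "cball x0 \<rho> \<subseteq> D" using assms(3) by (simp add: local_tangential_cone_def)
  interpret nskm_solution M D f \<beta> x0 \<tau> \<iota> x \<rho> \<eta> z
    using assms(3,4,6,7) z sub by unfold_locales auto
  have rank: "rank (Jac D f y) = CARD('n)" if "y \<in> cball x0 \<rho>" for y
    using assms(4) sub that by blast
  have cont: "continuous_on (cball x0 \<rho>) f"
    by (rule continuous_on_subset[OF differentiable_imp_continuous_on[OF assms(2)] sub])
  have factor: "expected_decrease_bound y \<le> nskm_factor D f \<eta> y * (norm (y - z))\<^sup>2"
    if "y \<in> cball x0 \<rho>" for y
    unfolding expected_decrease_bound_def
    by (rule expected_decrease_le_factor[OF tcc that z_ball fz rank[OF that]])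
  have cond: "AE \<omega> in M.
        real_cond_exp M (H k) (\<lambda>\<omega>. (norm (x k \<omega> - z))\<^sup>2) \<omega>
        \<le> nskm_factor D f \<eta> (x (k - 1) \<omega>) *
          real_cond_exp M (H k) (\<lambda>\<omega>. (norm (x (k - 1) \<omega> - z))\<^sup>2) \<omega>" if k: "1 \<le> k" for k
  proof -
    interpret finite_measure_subalgebra M "H k"
      using subalgebra_H by unfold_locales
    have "Suc (k - 1) = k" using k by simp
    then have "AE \<omega> in M. real_cond_exp M (H k) (\<lambda>\<omega>. (norm (x (k - 1) \<omega> - z))\<^sup>2) \<omega>
        = (norm (x (k - 1) \<omega> - z))\<^sup>2"
      using measurable_iterate_fun[of "\<lambda>y. (norm (y - z))\<^sup>2" "k - 1"]
      by (intro real_cond_exp_F_meas integrable_error) simp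
    with cond_exp_error_le[OF k] AE_space show ?thesis
    proof eventually_elim
      case (elim \<omega>)
      then show ?case using factor[OF iterate_in_ball[OF elim(2), of "k - 1"]] by simp
    qed
  qed
  show ?thesis
  proof (intro bexI[of _ z] conjI allI impI)
    show "converges_in_expectation M x z" by (rule converges[OF cont rank[OF z_ball]])
  qed (use z cond expectation_error_le[OF _ factor] in simp_all)
qed

end
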